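(* Let $(T,\mathcal{A},\mu)$ be a complete finite measure space and let $\Phi:T\times\mathbb{R}^n\rightrightarrows\mathbb{R}^m$ be a set-valued normal integrand with $\bar x\in\operatorname{dom}E_\Phi$. Suppose that on a neighborhood $U$ of $\bar x$ it admits the representation $$\Phi_t(x)=F(t,g_t(x))\quad\text{for all } x\in U\text{ and a.e. } t\in T,$$ where $F:T\times\mathbb{R}^q\rightrightarrows\mathbb{R}^m$ is a set-valued convex normal integrand and $g:T\times U\to\mathbb{R}^q$. Assume that: (a) (integrable boundedness) there exist $\rho>0$ and $\kappa\in L^1(T,\mathbb{R}_+)$ such that $\Phi_t(x)=F_t(g_t(x))\subset\kappa(t)\mathbb{B}$ for all $x\in\mathbb{B}_\rho(\bar x)$ and a.e. $t\in T$; (b) there is $\eta>0$ with $\mathbb{B}_\eta(\bar x)\subset U$ such that for a.e. $t\in T$ the mapping $g_t$ is continuously differentiable around $\bar x$ (on an open set containing $\mathbb{B}_\eta(\bar x)$), with gradients $\nabla g_t(x)$ uniformly bounded over all $x\in\mathbb{B}_\eta(\bar x)$ and a.e. $t\in T$; (c) for all $h\in\mathbb{R}^q$ with $\|h\|\le\eta$ the function $t\mapsto\operatorname{dist}(0;F_t(g_t(\bar x)+h))$ is integrable on $T$. Then $\Phi$ is integrably locally Lipschitzian around $\bar x$.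
   Context: $\mathbb{R}_+:=\{\alpha\in\mathbb{R}:\alpha>0\}$; $\mathbb{B}_r(\cdot)$ is the closed ball, $\mathbb{B}$ the closed unit ball; $\operatorname{dist}(x;\Omega)$ is the Euclidean distance with $\operatorname{dist}(x;\emptyset)=\infty$. We write $\Phi_t:=\Phi(t,\cdot)$, $F_t:=F(t,\cdot)$, $g_t:=g(t,\cdot)$. A mapping $G:T\times\mathbb{R}^d\rightrightarrows\mathbb{R}^m$ is a set-valued normal integrand if $\operatorname{gph}G_t$ is closed for all $t\in T$ and $\operatorname{gph}G\in\mathcal{A}\otimes\mathcal{B}(\mathbb{R}^d\times\mathbb{R}^m)$; it is a set-valued convex normal integrand if in addition $\operatorname{gph}G_t$ is convex for a.e. $t\in T$. $E_\Phi(x):=\int_T\Phi_t(x)d\mu=\{\int_T\mathsf{y}\,d\mu:\mathsf{y}\in L^1(T,\mathbb{R}^m),\ \mathsf{y}(t)\in\Phi_t(x)\text{ a.e.}\}$ (Aumann integral). Integrably locally Lipschitzian around $\bar x$: there exist $\eta>0$, $\ell\in L^1(T,\mathbb{R}_+)$ and $\hat T\in\mathcal{A}$ with $\mu(T\setminus\hat T)=0$ such that $\Phi_t(x)\subset\Phi_t(x')+\ell(t)\|x-x'\|\mathbb{B}$ for all $t\in\hat T$ and $x,x'\in\mathbb{B}_\eta(\bar x)$. *)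

theory Defs
  imports "HOL-Analysis.Analysis"
begin

text \<open>
  A set-valued mapping from a set \<open>X\<close> to a set \<open>Y\<close> is a function of type \<open>X \<Rightarrow> Y set\<close>.
  A measure space \<open>(T, A, \<mu>)\<close> is a measure \<open>M\<close> with \<open>T = space M\<close>; the values of \<open>T\<close>-indexed
  mappings outside \<open>space M\<close> are irrelevant.
\<close>

definition gph :: "('x \<Rightarrow> 'y set) \<Rightarrow> ('x \<times> 'y) set" where
  "gph S = {(x, y). y \<in> S x}"

definition mapping_dom :: "('x \<Rightarrow> 'y set) \<Rightarrow> 'x set" where
  "mapping_dom S = {x. S x \<noteq> {}}"

definition normal_integrand ::
  "'t measure \<Rightarrow> ('t \<Rightarrow> real^'d \<Rightarrow> (real^'m) set) \<Rightarrow> bool" where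
  "normal_integrand M G \<longleftrightarrow>
     (\<forall>t\<in>space M. closed (gph (G t))) \<and>
     {(t, x, y). t \<in> space M \<and> y \<in> G t x} \<in> sets (M \<Otimes>\<^sub>M (borel :: ((real^'d) \<times> (real^'m)) measure))"

definition convex_normal_integrand ::
  "'t measure \<Rightarrow> ('t \<Rightarrow> real^'d \<Rightarrow> (real^'m) set) \<Rightarrow> bool" where
  "convex_normal_integrand M G \<longleftrightarrow>
     normal_integrand M G \<and> (AE t in M. convex (gph (G t)))"

definition aumann_integral :: "'t measure \<Rightarrow> ('t \<Rightarrow> (real^'m) set) \<Rightarrow> (real^'m) set" where
  "aumann_integral M S = {integral\<^sup>L M y | y. integrable M y \<and> (AE t in M. y t \<in> S t)}"

definition expected_mapping ::
  "'t measure \<Rightarrow> ('t \<Rightarrow> real^'n \<Rightarrow> (real^'m) set) \<Rightarrow> real^'n \<Rightarrow> (real^'m) set" where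
  "expected_mapping M \<Phi> x = aumann_integral M (\<lambda>t. \<Phi> t x)"

text \<open>Integrable functions with values in the strictly positive reals.\<close>

definition integrable_pos :: "'t measure \<Rightarrow> ('t \<Rightarrow> real) \<Rightarrow> bool" where
  "integrable_pos M f \<longleftrightarrow> integrable M f \<and> (\<forall>t\<in>space M. 0 < f t)"

text \<open>
  The distance to the empty set is \<open>\<infinity>\<close> here, whereas \<^const>\<open>infdist\<close> and \<^const>\<open>setdist\<close> return
  \<open>0\<close> in that case.
\<close>

definition ext_dist :: "'x::metric_space \<Rightarrow> 'x set \<Rightarrow> ennreal" where
  "ext_dist x \<Omega> = (INF y\<in>\<Omega>. ennreal (dist x y))"

definition ennreal_integrable :: "'t measure \<Rightarrow> ('t \<Rightarrow> ennreal) \<Rightarrow> bool" where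
  "ennreal_integrable M f \<longleftrightarrow> f \<in> borel_measurable M \<and> (\<integral>\<^sup>+ t. f t \<partial>M) < \<infinity>"

text \<open>The gradient of a vector-valued function is its Jacobian matrix.\<close>

definition continuously_differentiable_on :: "(real^'n \<Rightarrow> real^'q) \<Rightarrow> (real^'n) set \<Rightarrow> bool" where
  "continuously_differentiable_on f S \<longleftrightarrow>
     (\<forall>x\<in>S. f differentiable (at x)) \<and> continuous_on S (\<lambda>x. jacobian f (at x))"

text \<open>The sum of two sets below is the Minkowski sum.\<close>

definition integrably_locally_Lipschitzian ::
  "'t measure \<Rightarrow> ('t \<Rightarrow> real^'n \<Rightarrow> (real^'m) set) \<Rightarrow> real^'n \<Rightarrow> bool" where
  "integrably_locally_Lipschitzian M \<Phi> xbar \<longleftrightarrow>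
     (\<exists>\<eta>>0. \<exists>l T\<^sub>0. integrable_pos M l \<and> T\<^sub>0 \<in> sets M \<and> emeasure M (space M - T\<^sub>0) = 0 \<and>
        (\<forall>t\<in>T\<^sub>0. \<forall>x\<in>cball xbar \<eta>. \<forall>x'\<in>cball xbar \<eta>.
           \<Phi> t x \<subseteq> \<Phi> t x' + (*\<^sub>R) (l t * norm (x - x')) ` cball 0 1))"

end

(*
  For almost every t the set of those h for which F_t (g_t xbar + h) meets the ball of radius beta t
  is convex, because gph F_t is.  By (c) it contains the finitely many vertices of a cube around 0
  once beta is an integrable function dominating the distances at these vertices, so it contains a
  ball of radius r.  Given y in F_t u and a second point v close to g_t xbar, prolong the segment
  from u to v by r/2 and pick z of norm at most beta t over the end point; the convex combination
  of y and z over v differs from y by at most (2/r) |u - v| (kappa t + beta t).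
*)

theory Submission
  imports Defs
begin

text \<open>The norm on \<open>real^'n^'q\<close> is the Frobenius norm, that is, the Euclidean norm
  of the vector of row norms; so Cauchy-Schwarz in each row suffices. It turns the gradient bound
  into a bound on the operator norm.\<close>

lemma norm_matrix_vector_mult_le:
  fixes A :: "real^'n^'q"
  shows "norm (A *v x) \<le> norm A * norm x"
proof -
  have "norm (A *v x) \<le> L2_set (\<lambda>i. norm (A $ i) * norm x) UNIV"
    unfolding norm_vec_def[of "A *v x"]
    by (rule L2_set_mono) (simp_all add: matrix_vector_mul_component Cauchy_Schwarz_ineq2)
  also have "\<dots> = norm A * norm x"
    by (simp add: norm_vec_def[of A] L2_set_left_distrib)
  finally show ?thesis .
qed

lemma lipschitz_on_jacobian_bound:
  fixes f :: "real^'n \<Rightarrow> real^'q"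
  assumes "convex S" "\<And>x. x \<in> S \<Longrightarrow> f differentiable (at x)"
    and "\<And>x. x \<in> S \<Longrightarrow> norm (jacobian f (at x)) \<le> K"
    and "x \<in> S" "y \<in> S"
  shows "norm (f x - f y) \<le> K * norm (x - y)"
proof (rule differentiable_bound[OF assms(1) _ _ assms(4,5)])
  fix z assume z: "z \<in> S"
  show "(f has_derivative (\<lambda>h. jacobian f (at z) *v h)) (at z within S)"
    using assms(2)[OF z] jacobian_works has_derivative_at_withinI by blast
  show "onorm (\<lambda>h. jacobian f (at z) *v h) \<le> K"
  proof (rule onorm_le)
    fix h
    show "norm (jacobian f (at z) *v h) \<le> K * norm h"
      using norm_matrix_vector_mult_le[of "jacobian f (at z)" h]
        mult_right_mono[OF assms(3)[OF z] norm_ge_zero[of h]] by linarith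
  qed
qed

lemma mem_scaleR_cball:
  fixes w :: "'a::real_normed_vector"
  assumes "norm w \<le> c"
  shows "w \<in> (*\<^sub>R) c ` cball 0 1"
\<comment> \<open>Dividing by \<open>c\<close> fails here, but then \<open>w\<close> is 0. This case
  occurs in the main proof when \<open>x = x'\<close>.\<close>
proof (cases "c = 0")
  case True
  then show ?thesis using assms by (auto intro!: image_eqI[of _ _ 0])
next
  case False
  then have "c > 0" using assms norm_ge_zero[of w] by linarith
  then show ?thesis
    using assms by (auto intro!: image_eqI[of _ _ "w /\<^sub>R c"] simp: field_simps)
qed

text \<open>The infimum need not be attained, hence the strict inequality. Finiteness excludes the
  empty set, whose distance \<open>enn2real\<close> would send to 0.\<close>

lemma ext_dist_bound:
  assumes "ext_dist (0::'a::real_normed_vector) S < \<infinity>" "enn2real (ext_dist 0 S) < b"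
  shows "\<exists>z\<in>S. norm z \<le> b"
proof -
  have "0 < b" using assms(2) enn2real_nonneg[of "ext_dist 0 S"] by linarith
  have "ext_dist 0 S < ennreal b"
    using assms \<open>0 < b\<close> by (cases "ext_dist 0 S") (auto simp: ennreal_less_iff)
  then obtain z where "z \<in> S" "ennreal (dist 0 z) < ennreal b"
    unfolding ext_dist_def INF_less_iff by blast
  then show ?thesis
    by (auto intro!: bexI[of _ z] simp: ennreal_less_iff)
qed

text \<open>A cube of half side \<open>r\<close> is a ball of the maximum norm, so it contains the
  Euclidean ball of radius \<open>r\<close>; its points have l1 norm at most
  \<open>DIM('a) * r\<close>, which the choice of \<open>r\<close> makes equal to \<eta>. Only its
  finitely many vertices will require an integrable distance.\<close>

lemma exists_finite_hull_between_cballs: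
  assumes "\<eta> > 0"
  shows "\<exists>s r. finite s \<and> r > 0 \<and> s \<subseteq> cball 0 \<eta> \<and> cball (0::'a::euclidean_space) r \<subseteq> convex hull s"
proof -
  define r where "r = \<eta> / DIM('a)"
  have r: "r > 0" "DIM('a) * r = \<eta>" using assms by (simp_all add: r_def)
  obtain s :: "'a set" where s: "finite s"
    "cbox (0 - (\<Sum>i\<in>Basis. r *\<^sub>R i)) (0 + (\<Sum>i\<in>Basis. r *\<^sub>R i)) = convex hull s"
    using cube_convex_hull[OF r(1)] by blast
  have hull: "h \<in> convex hull s \<longleftrightarrow> (\<forall>i\<in>Basis. \<bar>h \<bullet> i\<bar> \<le> r)" for h
    unfolding s(2)[symmetric] by (auto simp: mem_box abs_le_iff inner_diff_left minus_le_iff)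
  have "s \<subseteq> cball 0 \<eta>"
  proof
    fix h assume "h \<in> s"
    then have "\<forall>i\<in>Basis. \<bar>h \<bullet> i\<bar> \<le> r" using hull hull_inc by metis
    then have "(\<Sum>i\<in>Basis. \<bar>h \<bullet> i\<bar>) \<le> DIM('a) * r"
      using sum_bounded_above[of Basis "\<lambda>i. \<bar>h \<bullet> i\<bar>" r] by simp
    then show "h \<in> cball 0 \<eta>" using norm_le_l1[of h] r(2) by simp
  qed
  moreover have "cball 0 r \<subseteq> convex hull s"
    using hull Basis_le_norm order_trans by (metis mem_cball_0 subsetI)
  ultimately show ?thesis using s(1) r(1) by blast
qed

lemma convex_gph_bounded_selection:
  fixes G :: "'a::real_normed_vector \<Rightarrow> 'b::real_normed_vector set"
  assumes "convex (gph G)"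
    and "\<And>h. h \<in> s \<Longrightarrow> \<exists>z\<in>G (u + h). norm z \<le> b" and "h \<in> convex hull s"
  shows "\<exists>z\<in>G (u + h). norm z \<le> b"
proof -
  define A where "A = {h. \<exists>z\<in>G (u + h). norm z \<le> b}"
  have "convex A"
  proof (rule convexI)
    fix h k and p q :: real
    assume "h \<in> A" "k \<in> A" and pq: "0 \<le> p" "0 \<le> q" "p + q = 1"
    then obtain y z where yz: "y \<in> G (u + h)" "norm y \<le> b" "z \<in> G (u + k)" "norm z \<le> b"
      by (auto simp: A_def)
    have "p *\<^sub>R (u + h, y) + q *\<^sub>R (u + k, z) \<in> gph G"
      using assms(1) yz pq by (intro convexD) (auto simp: gph_def)
    \<comment> \<open>Since \<open>p + q = 1\<close>, the shift by \<open>u\<close> commutes with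
      the convex combination.\<close>
    moreover have "p *\<^sub>R (u + h) + q *\<^sub>R (u + k) = (p + q) *\<^sub>R u + (p *\<^sub>R h + q *\<^sub>R k)"
      by (simp add: algebra_simps)
    ultimately have "p *\<^sub>R y + q *\<^sub>R z \<in> G (u + (p *\<^sub>R h + q *\<^sub>R k))"
      using pq(3) by (simp add: gph_def)
    moreover have "p *\<^sub>R y + q *\<^sub>R z \<in> cball 0 b"
      using yz pq by (intro convexD[OF convex_cball]) auto
    ultimately show "p *\<^sub>R h + q *\<^sub>R k \<in> A" by (auto simp: A_def)
  qed
  moreover have "s \<subseteq> A" using assms(2) by (auto simp: A_def)
  ultimately show ?thesis using assms(3) hull_minimal[of s A convex] by (auto simp: A_def)
qed

text \<open>Keeping \<open>v\<close> within \<open>r / 2\<close> of the centre leaves room to go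
  \<open>r / 2\<close> beyond it and still find a bounded point of the graph. The point
  \<open>u\<close> may lie anywhere.\<close>

lemma convex_gph_lipschitz:
  fixes G :: "'a::real_normed_vector \<Rightarrow> 'b::real_normed_vector set"
  assumes "convex (gph G)" "r > 0"
    and sel: "\<And>w. norm (w - u\<^sub>0) \<le> r \<Longrightarrow> \<exists>z\<in>G w. norm z \<le> b"
    and "norm (v - u\<^sub>0) \<le> r / 2" "y \<in> G u" "norm y \<le> k"
  shows "\<exists>z\<in>G v. norm (y - z) \<le> 2 / r * (k + b) * norm (u - v)"
proof (cases "u = v")
  case True
  then show ?thesis using assms by auto
next
  case False
  define d where "d = norm (v - u)"
  have d: "d > 0" using False by (simp add: d_def)
  define w where "w = v + (r / (2 * d)) *\<^sub>R (v - u)"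
  have "norm (w - v) = r / 2" using d assms(2) by (simp add: w_def flip: d_def)
  then have "norm (w - u\<^sub>0) \<le> r"
    using assms(4) norm_triangle_ineq[of "w - v" "v - u\<^sub>0"] by simp
  then obtain x where x: "x \<in> G w" "norm x \<le> b" using sel by blast
  \<comment> \<open>The weight that places \<open>v\<close> on the segment from \<open>u\<close> to
    \<open>w\<close>, whose length is \<open>d + r / 2\<close>; dropping \<open>d\<close> from the
    denominator gives the linear bound on \<open>c\<close>.\<close>
  define c where "c = d / (d + r / 2)"
  have c: "0 \<le> c" "c \<le> 1" "c \<le> 2 / r * d"
    using d assms(2) by (auto simp: c_def field_simps)
  have "c * (1 + r / (2 * d)) = 1"
    using d assms(2) by (simp add: c_def divide_simps)
  moreover have "(1 - c) *\<^sub>R u + c *\<^sub>R w = u + (c * (1 + r / (2 * d))) *\<^sub>R (v - u)"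
    by (simp add: w_def algebra_simps)
  ultimately have v: "(1 - c) *\<^sub>R u + c *\<^sub>R w = v" by simp
  define z where "z = (1 - c) *\<^sub>R y + c *\<^sub>R x"
  have "(1 - c) *\<^sub>R (u, y) + c *\<^sub>R (w, x) \<in> gph G"
    using assms x c by (intro convexD) (auto simp: gph_def)
  then have "z \<in> G v" using v by (simp add: gph_def z_def)
  moreover have "norm (y - z) \<le> 2 / r * (k + b) * norm (u - v)"
  proof -
    have "y - z = c *\<^sub>R (y - x)" by (simp add: z_def algebra_simps)
    then have "norm (y - z) = c * norm (y - x)" using c by simp
    also have "\<dots> \<le> (2 / r * d) * (k + b)"
      using c x assms(2,6) d norm_triangle_ineq4[of y x] by (intro mult_mono) auto
    finally show ?thesis by (simp add: d_def norm_minus_commute algebra_simps)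
  qed
  ultimately show ?thesis by blast
qed

theorem theorem6p3:
  fixes M :: "'t measure"
    and \<Phi> :: "'t \<Rightarrow> real^'n \<Rightarrow> (real^'m) set"
    and F :: "'t \<Rightarrow> real^'q \<Rightarrow> (real^'m) set"
    and g :: "'t \<Rightarrow> real^'n \<Rightarrow> real^'q"
    and U :: "(real^'n) set"
    and xbar :: "real^'n"
    and \<eta> :: real
  assumes "complete_measure M" and "finite_measure M"
    and "normal_integrand M \<Phi>"
    and "xbar \<in> mapping_dom (expected_mapping M \<Phi>)"
    and "xbar \<in> interior U"
    and "convex_normal_integrand M F"
    and representation: "AE t in M. \<forall>x\<in>U. \<Phi> t x = F t (g t x)"
    and bounded: "\<exists>\<rho>>0. \<exists>\<kappa>. integrable_pos M \<kappa> \<and>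
      (AE t in M. \<forall>x\<in>cball xbar \<rho>. \<Phi> t x \<subseteq> (*\<^sub>R) (\<kappa> t) ` cball 0 1)"
    and "\<eta> > 0" and "cball xbar \<eta> \<subseteq> U"
    and smooth: "AE t in M. \<exists>V. open V \<and> cball xbar \<eta> \<subseteq> V \<and> V \<subseteq> U \<and>
      continuously_differentiable_on (g t) V"
    and gradient_bounded: "\<exists>K. AE t in M. \<forall>x\<in>cball xbar \<eta>. norm (jacobian (g t) (at x)) \<le> K"
    and dist_integrable: "\<And>h. norm h \<le> \<eta> \<Longrightarrow>
      ennreal_integrable M (\<lambda>t. ext_dist 0 (F t (g t xbar + h)))"
  shows "integrably_locally_Lipschitzian M \<Phi> xbar"
proof -
  interpret finite_measure M by fact
  obtain \<rho> \<kappa> where \<rho>: "\<rho> > 0" and \<kappa>: "integrable M \<kappa>" "\<And>t. t \<in> space M \<Longrightarrow> 0 < \<kappa> t"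
    and \<kappa>_bound: "AE t in M. \<forall>x\<in>cball xbar \<rho>. \<Phi> t x \<subseteq> (*\<^sub>R) (\<kappa> t) ` cball 0 1"
    using bounded by (auto simp: integrable_pos_def)
  obtain K\<^sub>0 where K\<^sub>0: "AE t in M. \<forall>x\<in>cball xbar \<eta>. norm (jacobian (g t) (at x)) \<le> K\<^sub>0"
    using gradient_bounded by blast
  \<comment> \<open>A positive constant is needed to divide by \<open>K\<close> below and to keep
    \<open>l\<close> strictly positive.\<close>
  define K where "K = max 1 K\<^sub>0"
  have K: "K \<ge> 1" "K\<^sub>0 \<le> K" by (auto simp: K_def)
  obtain s :: "(real^'q) set" and r where s: "finite s" "r > 0" "s \<subseteq> cball 0 \<eta>"
    "cball 0 r \<subseteq> convex hull s"
    using exists_finite_hull_between_cballs[OF \<open>\<eta> > 0\<close>] by blast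
  define D where "D h t = ext_dist 0 (F t (g t xbar + h))" for h t
  have D: "D h \<in> borel_measurable M" "(\<integral>\<^sup>+ t. D h t \<partial>M) < \<infinity>" if "h \<in> s" for h
    using dist_integrable[of h] that s(3) by (auto simp: ennreal_integrable_def D_def[abs_def])
  have D_finite: "AE t in M. D h t < \<infinity>" if "h \<in> s" for h
    using nn_integral_PInf_AE[of "D h" M] D[OF that] by (auto simp: less_top)
  have D_integrable: "integrable M (\<lambda>t. enn2real (D h t))" if "h \<in> s" for h
  proof (rule integrableI_nonneg)
    \<comment> \<open>The integrands differ where \<open>D h t\<close> is infinite, because
      \<open>enn2real\<close> returns 0 there; this is a null set.\<close>
    have "(\<integral>\<^sup>+ t. ennreal (enn2real (D h t)) \<partial>M) = (\<integral>\<^sup>+ t. D h t \<partial>M)"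
      using D_finite[OF that] by (intro nn_integral_cong_AE) (auto simp: less_top)
    then show "(\<integral>\<^sup>+ t. ennreal (enn2real (D h t)) \<partial>M) < \<infinity>" using D[OF that] by simp
  qed (use D[OF that] in auto)
  \<comment> \<open>The summand 1 gives the strict inequality that \<open>ext_dist_bound\<close>
    asks for; it is integrable because the measure is finite.\<close>
  define \<beta> where "\<beta> t = (\<Sum>h\<in>s. enn2real (D h t)) + 1" for t
  have \<beta>: "integrable M \<beta>" "\<And>t. \<beta> t > 0"
    using D_integrable by (auto simp: \<beta>_def[abs_def] sum_nonneg add_nonneg_pos)
  \<comment> \<open>The Lipschitz modulus of \<open>F t\<close> from
    \<open>convex_gph_lipschitz\<close>, times the Lipschitz constant \<open>K\<close> of
    \<open>g t\<close>.\<close>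
  define l where "l t = 2 / r * (\<kappa> t + \<beta> t) * K" for t
  have "integrable_pos M l"
    unfolding integrable_pos_def
  proof (intro conjI ballI)
    show "integrable M l" using \<kappa> \<beta> by (simp add: l_def[abs_def])
    show "0 < l t" if "t \<in> space M" for t
      unfolding l_def using \<kappa>(2)[OF that] \<beta>(2)[of t] K s(2)
      by (intro mult_pos_pos add_pos_pos divide_pos_pos) auto
  qed
  \<comment> \<open>Within \<eta> the representation and the Lipschitz bound on \<open>g t\<close>
    hold, within \<rho> the bound \<kappa> holds, and \<open>r / (2 * K)\<close> keeps
    \<open>g t x'\<close> within \<open>r / 2\<close> of \<open>g t xbar\<close>.\<close>
  define \<gamma> where "\<gamma> = Min {\<eta>, \<rho>, r / (2 * K)}"
  have \<gamma>: "\<gamma> > 0" "\<gamma> \<le> \<eta>" "\<gamma> \<le> \<rho>" "\<gamma> \<le> r / (2 * K)"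
    using \<open>\<eta> > 0\<close> \<rho> s(2) K by (auto simp: \<gamma>_def)
  define good where "good t \<longleftrightarrow> (\<forall>x\<in>cball xbar \<gamma>. \<forall>x'\<in>cball xbar \<gamma>.
    \<Phi> t x \<subseteq> \<Phi> t x' + (*\<^sub>R) (l t * norm (x - x')) ` cball 0 1)" for t
  have "AE t in M. convex (gph (F t))"
    using \<open>convex_normal_integrand M F\<close> by (simp add: convex_normal_integrand_def)
  \<comment> \<open>One null set serves all vertices, as \<open>s\<close> is finite.\<close>
  moreover have "AE t in M. \<forall>h\<in>s. D h t < \<infinity>"
    using s(1) D_finite by (simp add: AE_finite_all)
  ultimately have "AE t in M. good t"
    using representation \<kappa>_bound smooth K\<^sub>0 AE_space
  proof eventually_elim
    case (elim t)
    have dist: "\<exists>z\<in>F t (g t xbar + h). norm z \<le> \<beta> t" if "h \<in> s" for h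
    proof (rule ext_dist_bound)
      show "ext_dist 0 (F t (g t xbar + h)) < \<infinity>" using elim that by (auto simp: D_def)
      have "enn2real (D h t) \<le> (\<Sum>h\<in>s. enn2real (D h t))"
        using s(1) that by (intro member_le_sum) auto
      then show "enn2real (ext_dist 0 (F t (g t xbar + h))) < \<beta> t" by (simp add: \<beta>_def D_def)
    qed
    have sel: "\<exists>z\<in>F t w. norm z \<le> \<beta> t" if "norm (w - g t xbar) \<le> r" for w
    proof -
      have "w - g t xbar \<in> convex hull s" using that s(4) by auto
      from convex_gph_bounded_selection[OF elim(1) dist this] show ?thesis by simp
    qed
    have g_lip: "norm (g t x - g t x') \<le> K * norm (x - x')"
      if "x \<in> cball xbar \<eta>" "x' \<in> cball xbar \<eta>" for x x'
    proof (rule lipschitz_on_jacobian_bound[OF convex_cball _ _ that])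
      fix z assume "z \<in> cball xbar \<eta>"
      then show "norm (jacobian (g t) (at z)) \<le> K"
        using elim(6) K(2) order_trans by blast
      \<comment> \<open>The open set \<open>V\<close> around the closed ball gives full
        differentiability at its boundary points too.\<close>
      show "g t differentiable (at z)"
        using elim(5) \<open>z \<in> cball xbar \<eta>\<close> unfolding continuously_differentiable_on_def by blast
    qed
    show "good t"
      unfolding good_def
    proof (intro ballI subsetI)
      fix x x' y assume x: "x \<in> cball xbar \<gamma>" "x' \<in> cball xbar \<gamma>" and y: "y \<in> \<Phi> t x"
      have x\<eta>: "x \<in> cball xbar \<eta>" "x' \<in> cball xbar \<eta>" "xbar \<in> cball xbar \<eta>" and "x \<in> cball xbar \<rho>"
        using x \<gamma> by auto
      have rep: "\<Phi> t x = F t (g t x)" "\<Phi> t x' = F t (g t x')"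
        using elim x\<eta> \<open>cball xbar \<eta> \<subseteq> U\<close> by blast+
      have "y \<in> (*\<^sub>R) (\<kappa> t) ` cball 0 1"
        using elim(4) \<open>x \<in> cball xbar \<rho>\<close> y by blast
      \<comment> \<open>Positivity of \<kappa> is known only on \<open>space M\<close>, which is why
        \<open>AE_space\<close> was added to the facts above.\<close>
      then have "norm y \<le> \<kappa> t"
        using \<kappa>(2)[of t] elim(7) by (auto simp: mult_left_le)
      moreover have "norm (g t x' - g t xbar) \<le> r / 2"
      proof -
        have "norm (g t x' - g t xbar) \<le> K * norm (x' - xbar)" by (rule g_lip[OF x\<eta>(2,3)])
        also have "\<dots> \<le> K * (r / (2 * K))"
          using x(2) \<gamma>(4) K(1) by (intro mult_left_mono) (auto simp: dist_norm norm_minus_commute)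
        finally show ?thesis using K(1) by simp
      qed
      ultimately obtain z where z: "z \<in> \<Phi> t x'"
        "norm (y - z) \<le> 2 / r * (\<kappa> t + \<beta> t) * norm (g t x - g t x')"
        using convex_gph_lipschitz[OF elim(1) s(2) sel, where v="g t x'" and y=y and u="g t x" and k="\<kappa> t"] y
        unfolding rep by blast
      note z(2)
      also have "2 / r * (\<kappa> t + \<beta> t) * norm (g t x - g t x') \<le> 2 / r * (\<kappa> t + \<beta> t) * (K * norm (x - x'))"
        using g_lip[OF x\<eta>(1,2)] s(2) \<kappa>(2)[of t] \<beta>(2)[of t] elim(7)
        by (intro mult_left_mono) auto
      finally have diff: "y - z \<in> (*\<^sub>R) (l t * norm (x - x')) ` cball 0 1"
        by (intro mem_scaleR_cball) (simp add: l_def mult_ac)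
      show "y \<in> \<Phi> t x' + (*\<^sub>R) (l t * norm (x - x')) ` cball 0 1"
        using set_plus_intro[OF z(1) diff] by simp
    qed
  qed
  \<comment> \<open>The set of good \<open>t\<close> need not be measurable by itself, so the
    complement of a measurable null set \<open>N\<close> covering the bad \<open>t\<close> serves as
    \<open>T\<^sub>0\<close>.\<close>
  then obtain N where N: "N \<in> null_sets M" "{t \<in> space M. \<not> good t} \<subseteq> N"
    unfolding eventually_ae_filter by blast
  have "space M - (space M - N) = N" using N(1) sets.sets_into_space by blast
  then have null: "emeasure M (space M - (space M - N)) = 0" using N(1) by auto
  have "space M - N \<in> sets M" using N(1) by auto
  moreover have "\<forall>t\<in>space M - N. good t" using N(2) by blast
  ultimately show ?thesis
    unfolding integrably_locally_Lipschitzian_def good_def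
    using \<gamma>(1) \<open>integrable_pos M l\<close> null
    by (intro exI[of _ \<gamma>] exI[of _ l] exI[of _ "space M - N"] conjI) simp_all
qed

end
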